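(* Let $G$ be a finite simple graph with vertex set $V(G)$. For each vertex $v$ let $d_v$ be the degree of $v$ in $G$, and let $i(G)$ denote the number of independent sets of $G$. Then \[ i(G) \ge \prod_{v \in V(G)} (d_v + 2)^{1/(d_v+1)}. \] Equality holds if and only if $G$ is a disjoint union of cliques.
   Context: All graphs are finite and simple (undirected). The empty set counts as an independent set. A clique here means a complete graph $K_m$ with $m \ge 1$ vertices (so an isolated vertex is a clique $K_1$). In a disjoint union of cliques, the components may be complete graphs of different sizes. *)

theory Defs
  imports Complex_Main "Graph_Theory.Graph_Theory"
begin

text \<open>
  A finite simple graph is a \<^term>\<open>graph G\<close> of the library: a finite, loop-free digraph without
  parallel arcs whose adjacency relation is symmetric. An undirected edge is thus a pair of
  opposite arcs, and the degree of a vertex is its \<^const>\<open>out_degree\<close>.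
\<close>

definition independent_set :: "('a, 'b) pre_digraph \<Rightarrow> 'a set \<Rightarrow> bool" where
  "independent_set G S \<longleftrightarrow> S \<subseteq> verts G \<and> (\<forall>u\<in>S. \<forall>v\<in>S. \<not> u \<rightarrow>\<^bsub>G\<^esub> v)"

definition num_independent_sets :: "('a, 'b) pre_digraph \<Rightarrow> nat" where
  "num_independent_sets G = card {S. independent_set G S}"

definition clique_graph :: "('a, 'b) pre_digraph \<Rightarrow> bool" where
  "clique_graph H \<longleftrightarrow> (\<exists>m\<ge>1. K\<^bsub>m\<^esub> H)"

text \<open>
  The explicit argument of \<^const>\<open>pre_digraph.Union\<close> only supplies the tail and head maps, which the
  subgraphs share with \<open>G\<close>. The family may be empty, so the graph without vertices is included.
\<close>
definition disjoint_union_of_cliques :: "('a, 'b) pre_digraph \<Rightarrow> bool" where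
  "disjoint_union_of_cliques G \<longleftrightarrow>
     (\<exists>\<C>. (\<forall>H\<in>\<C>. subgraph H G \<and> clique_graph H)
        \<and> (\<forall>H\<in>\<C>. \<forall>H'\<in>\<C>. H \<noteq> H' \<longrightarrow> verts H \<inter> verts H' = {})
        \<and> G = pre_digraph.Union G \<C>)"

end

theory Submission
  imports Defs
begin

text \<open>
  Write $f(d) = (d+2)^{1/(d+1)}$; a clique on $d+1$ vertices has $d+2$ independent sets and
  $d+1$ vertices of degree $d$, so each of its vertices carries the factor $f(d)$.

  The proof is by induction on the vertex set, removing a vertex $v$ of maximum degree $d$. The
  independent sets avoiding $v$ are those of $G - v$, and those containing $v$ correspond to the
  independent sets of $G - N[v]$, so $i(G) = i(G - v) + i(G - N[v])$. Let $B$ be the product of the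
  $f(d_u)$ over $u \notin N[v]$. In $G - v$ exactly the neighbours of $v$ lose one from their
  degree, so the induction hypothesis gives $i(G - v) \ge B \prod_{u \in N(v)} f(d_u - 1)$. In
  $G - N[v]$ degrees only drop, and $f$ is decreasing, so $i(G - N[v]) \ge B$. What remains is an
  inequality about the degrees around $v$ alone:
  \[ \prod_{u \in N(v)} f(d_u - 1) + 1 \ge f(d) \prod_{u \in N(v)} f(d_u), \]
  which is lemma \<open>clique_root_neighbourhood\<close>. It is an equality when all $d_u$ equal $d$, both sides
  being $d+2$ then. Let $P$ be the product on the left. The tangent to the convex function
  $\ln P \mapsto \ln (P+1)$ at the extremal value $P = d+1$ has slope $c = (d+1)/(d+2)$. Replacing
  the function by this tangent turns the inequality into a sum over $u$, in which every term is
  nonnegative because $c \ln f(k-1) - \ln f(k)$ decreases for $0 < k \le d$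
  (lemma \<open>ln_over_decrement\<close>). Choosing $v$ of maximum degree is what gives $d_u \le d$.

  Equality forces equality at each of these places: all neighbours of $v$ have degree $d$, no vertex
  outside $N[v]$ has lost a neighbour, and $G - N[v]$ is extremal. The first two facts make $N[v]$ a
  clique with no edge leaving it. Conversely a union of cliques has all these properties, and $G - v$
  is again a union of cliques, hence extremal by induction; the same recursion shows that the bound
  is attained.
  Being a union of cliques is expressed by transitivity of adjacency between distinct vertices
  (the predicate \<open>cluster\<close>), because that condition passes to induced subgraphs at once.
\<close>

section \<open>Monotonicity of logarithmic quotients\<close>

lemma ln_less_minus_one:
  fixes x :: real
  assumes "0 < x" "x \<noteq> 1" shows "ln x < x - 1"
  using ln_le_minus_one [of x] ln_eq_minus_one [of x] assms by fastforce

lemma two_x_less_ln: assumes "(0::real) < x" shows "2 * x < (x + 2) * ln (x + 1)"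
proof -
  let ?h = "\<lambda>t::real. (t + 2) * ln (t + 1) - 2 * t"
  have "?h 0 < ?h x"
  proof (rule DERIV_pos_imp_increasing_open [OF assms])
    fix t :: real assume t: "0 < t" "t < x"
    have "(?h has_real_derivative ln (t + 1) + (t + 2) / (t + 1) - 2) (at t)"
      using t by (auto intro!: derivative_eq_intros)
    moreover have "ln (1 / (t + 1)) < 1 / (t + 1) - 1"
      using t by (intro ln_less_minus_one) auto
    then have "0 < ln (t + 1) + (t + 2) / (t + 1) - 2"
      using t by (simp add: ln_div field_simps)
    ultimately show "\<exists>y. (?h has_real_derivative y) (at t) \<and> 0 < y" by blast
  qed (auto intro!: continuous_intros)
  then show ?thesis by simp
qed

text \<open>
  The numerator is $\int_0^x \ln (1 + t)\,dt$. This quotient governs the derivatives of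
  $\ln (x + 1) / x$ and of its shift by one, and comparing those two derivatives is the analytic core
  of the degree inequality.
\<close>
definition ln_integral_ratio :: "real \<Rightarrow> real" where
  "ln_integral_ratio x = ((x + 1) * ln (x + 1) - x) / x\<^sup>2"

lemma ln_integral_ratio_pos:
  assumes "0 < x" shows "0 < ln_integral_ratio x"
proof -
  have "ln (1 / (x + 1)) < 1 / (x + 1) - 1"
    using assms by (intro ln_less_minus_one) auto
  then have "0 < (x + 1) * ln (x + 1) - x"
    using assms by (simp add: ln_div field_simps)
  then show ?thesis using assms by (simp add: ln_integral_ratio_def)
qed

text \<open>
  Substituting $t = xs$ turns the quotient into $\int_0^1 \ln (1 + xs) / x\,ds$, whose integrand
  decreases in $x$. The formal proof instead computes the derivative, whose sign is that of
  $2x - (x + 2) \ln (x + 1)$.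
\<close>
lemma ln_integral_ratio_strict_antimono:
  assumes "0 < x" "x < y" shows "ln_integral_ratio y < ln_integral_ratio x"
proof (rule DERIV_neg_imp_decreasing [OF assms(2)])
  fix t assume t: "x \<le> t" "t \<le> y"
  then have t0: "0 < t" using assms by simp
  have "(ln_integral_ratio has_real_derivative (2 * t - (t + 2) * ln (t + 1)) / t ^ 3) (at t)"
    unfolding ln_integral_ratio_def using t0
    by (auto intro!: derivative_eq_intros) (auto simp: divide_simps, algebra)
  moreover have "(2 * t - (t + 2) * ln (t + 1)) / t ^ 3 < 0"
    using two_x_less_ln [OF t0] t0 by (simp add: divide_neg_pos)
  ultimately show "\<exists>z. (ln_integral_ratio has_real_derivative z) (at t) \<and> z < 0" by blast
qed

lemma DERIV_ln_over:
  fixes x :: real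
  assumes "0 < x"
  shows "((\<lambda>t. ln (t + 1) / t) has_real_derivative - (ln_integral_ratio x / (x + 1))) (at x)"
  unfolding ln_integral_ratio_def using assms
  by (auto intro!: derivative_eq_intros) (simp add: field_simps power2_eq_square, simp only: minus_divide_left minus_diff_eq)

lemma DERIV_ln_over_Suc:
  fixes x :: real
  assumes "0 < x"
  shows "((\<lambda>t. ln (t + 2) / (t + 1)) has_real_derivative - (ln_integral_ratio (x + 1) / (x + 2))) (at x)"
  using DERIV_shift [of "\<lambda>t. ln (t + 1) / t" "- (ln_integral_ratio (x + 1) / (x + 2))" x 1]
    DERIV_ln_over [of "x + 1"] assms by (simp add: add.commute add.left_commute)

lemma ln_over_strict_antimono:
  fixes x y :: real
  assumes "0 < x" "x < y" shows "ln (y + 1) / y < ln (x + 1) / x"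
proof (rule DERIV_neg_imp_decreasing [OF assms(2)])
  fix t assume "x \<le> t" "t \<le> y"
  then have t: "0 < t" using assms by simp
  then have "- (ln_integral_ratio t / (t + 1)) < 0"
    using ln_integral_ratio_pos [OF t] by simp
  with DERIV_ln_over [OF t]
  show "\<exists>z. ((\<lambda>t. ln (t + 1) / t) has_real_derivative z) (at t) \<and> z < 0" by blast
qed

text \<open>
  In terms of $f(k) = (k+2)^{1/(k+1)}$ this compares the increments of $\ln f$ between $x$ and $d$
  with those between $x - 1$ and $d - 1$: lowering degrees by one magnifies the increments by more
  than the factor $(d+2)/(d+1)$. The derivatives at $t$ of the two functions involved are
  $- m(t+1)/(t+2)$ and $- m(t)/(t+1)$, where $m$ is the integral quotient. Since $m$ decreases, the
  factor $(t+1)/(t+2)$ suffices at $t$, and it is at most $(d+1)/(d+2)$ for $t \le d$.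
\<close>
lemma ln_over_decrement:
  fixes d x :: real
  assumes "0 < x" "x < d"
  shows "ln (x + 2) / (x + 1) - ln (d + 2) / (d + 1)
       < (d + 1) / (d + 2) * (ln (x + 1) / x - ln (d + 1) / d)"
proof -
  define c where "c = (d + 1) / (d + 2)"
  let ?D = "\<lambda>t. c * (ln (t + 1) / t) - ln (t + 2) / (t + 1)"
  have "?D d < ?D x"
  proof (rule DERIV_neg_imp_decreasing [OF assms(2)])
    fix t assume tt: "x \<le> t" "t \<le> d"
    then have t: "0 < t" using assms by simp
    let ?z = "c * - (ln_integral_ratio t / (t + 1)) - - (ln_integral_ratio (t + 1) / (t + 2))"
    have "(?D has_real_derivative ?z) (at t)"
      by (intro DERIV_diff DERIV_cmult DERIV_ln_over DERIV_ln_over_Suc t)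
    moreover have "?z < 0"
    proof -
      have "ln_integral_ratio (t + 1) / (t + 2) < ln_integral_ratio t / (t + 2)"
        using ln_integral_ratio_strict_antimono [of t "t + 1"] t by (simp add: divide_strict_right_mono)
      also have "\<dots> = (t + 1) / (t + 2) * (ln_integral_ratio t / (t + 1))"
        using t by simp
      also have "\<dots> \<le> c * (ln_integral_ratio t / (t + 1))"
      proof (rule mult_right_mono)
        show "(t + 1) / (t + 2) \<le> c" using t tt by (simp add: c_def divide_simps) argo
        show "0 \<le> ln_integral_ratio t / (t + 1)" using ln_integral_ratio_pos [OF t] t by simp
      qed
      finally show ?thesis by simp
    qed
    ultimately show "\<exists>z. (?D has_real_derivative z) (at t) \<and> z < 0" by blast
  qed
  then show ?thesis by (simp add: c_def right_diff_distrib)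
qed

section \<open>The degree inequality at a vertex\<close>
definition clique_root :: "nat \<Rightarrow> real" where
  "clique_root d = (real d + 2) powr (1 / (real d + 1))"

lemma clique_root_pos [simp]: "0 < clique_root d"
  by (simp add: clique_root_def)

lemma clique_root_nonzero [simp]: "clique_root d \<noteq> 0"
  by (simp add: clique_root_def)

lemma ln_clique_root: "ln (clique_root d) = ln (real d + 2) / (real d + 1)"
  by (simp add: clique_root_def)

lemma ln_clique_root_pred:
  "0 < d \<Longrightarrow> ln (clique_root (d - 1)) = ln (real d + 1) / real d"
  by (cases d) (simp_all add: ln_clique_root add.commute)

lemma clique_root_strict_antimono:
  assumes "d < e" shows "clique_root e < clique_root d"
proof -
  have "ln (clique_root e) < ln (clique_root d)"
    using ln_over_strict_antimono [of "real d + 1" "real e + 1"] assms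
    by (simp add: ln_clique_root add.assoc)
  then show ?thesis by simp
qed

lemma clique_root_antimono: "d \<le> e \<Longrightarrow> clique_root e \<le> clique_root d"
  using clique_root_strict_antimono [of d e] by (cases "d = e") auto

text \<open>
  The right-hand side is a convex function of $\ln p$, and the left-hand side is its tangent at
  $p = n$. Equivalently, this is the weighted inequality of arithmetic and geometric means for $p/n$
  and $1$ with weights $n/(n+1)$ and $1/(n+1)$.
\<close>
lemma ln_Suc_tangent:
  fixes p n :: real
  assumes "0 < p" "0 < n"
  shows "ln (n + 1) + n / (n + 1) * (ln p - ln n) \<le> ln (p + 1)"
proof -
  have expand: "ln (p * (n + 1) / (n * (p + 1))) = ln p + ln (n + 1) - ln n - ln (p + 1)"
    "ln ((n + 1) / (p + 1)) = ln (n + 1) - ln (p + 1)"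
    using assms by (simp_all add: ln_div ln_mult)
  have "ln (p * (n + 1) / (n * (p + 1))) \<le> p * (n + 1) / (n * (p + 1)) - 1"
    using assms by (intro ln_le_minus_one) auto
  moreover have "ln ((n + 1) / (p + 1)) \<le> (n + 1) / (p + 1) - 1"
    using assms by (intro ln_le_minus_one) auto
  ultimately have "n * ln (p * (n + 1) / (n * (p + 1))) + ln ((n + 1) / (p + 1))
      \<le> n * (p * (n + 1) / (n * (p + 1)) - 1) + ((n + 1) / (p + 1) - 1)"
    using assms by (intro add_mono mult_left_mono) auto
  also have "\<dots> = 0" using assms by (simp add: divide_simps) (simp add: algebra_simps)
  finally have "n * (ln p - ln n) + (n + 1) * (ln (n + 1) - ln (p + 1)) \<le> 0"
    unfolding expand by (simp add: algebra_simps)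
  then show ?thesis using assms by (simp add: field_simps)
qed

text \<open>
  Here $N$ is the neighbourhood of a vertex of maximum degree and $k$ the degree function; the factors
  at $k - 1$ are those after deletion of the vertex, and the summand $1$ accounts for the
  independent sets that contain it. The function \<open>gap\<close> is the contribution of a single neighbour after
  taking logarithms and passing to the tangent at $P = d+1$.
\<close>
lemma clique_root_neighbourhood:
  fixes k :: "'a \<Rightarrow> nat"
  assumes "finite N" and k: "\<And>u. u \<in> N \<Longrightarrow> 0 < k u \<and> k u \<le> card N"
  shows "clique_root (card N) * (\<Prod>u\<in>N. clique_root (k u)) \<le> (\<Prod>u\<in>N. clique_root (k u - 1)) + 1"
    and "clique_root (card N) * (\<Prod>u\<in>N. clique_root (k u)) = (\<Prod>u\<in>N. clique_root (k u - 1)) + 1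
          \<longleftrightarrow> (\<forall>u\<in>N. k u = card N)"
proof -
  define d where "d = card N"
  define c where "c = (real d + 1) / (real d + 2)"
  define P where "P = (\<Prod>u\<in>N. clique_root (k u - 1))"
  define Q where "Q = (\<Prod>u\<in>N. clique_root (k u))"
  have pos: "0 < P" "0 < Q" by (simp_all add: P_def Q_def prod_pos)
  have lnP: "ln P = (\<Sum>u\<in>N. ln (clique_root (k u - 1)))"
    and lnQ: "ln Q = (\<Sum>u\<in>N. ln (clique_root (k u)))"
    unfolding P_def Q_def using assms(1) by (simp_all add: ln_prod)
  define gap where "gap u = c * (ln (clique_root (k u - 1)) - ln (clique_root (d - 1)))
      - (ln (clique_root (k u)) - ln (clique_root d))" for u
  have gap: "0 \<le> gap u \<and> (gap u = 0 \<longleftrightarrow> k u = d)" if "u \<in> N" for u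
  proof (cases "k u = d")
    case False
    then have ku: "0 < k u" "k u < d" using k [OF that] by (auto simp: d_def)
    have "gap u = c * (ln (real (k u) + 1) / real (k u) - ln (real d + 1) / real d)
        - (ln (real (k u) + 2) / (real (k u) + 1) - ln (real d + 2) / (real d + 1))"
      using ku by (simp only: gap_def ln_clique_root [of d] ln_clique_root [of "k u"]
          ln_clique_root_pred less_trans [OF ku])
    then show ?thesis
      using ln_over_decrement [of "real (k u)" "real d"] ku by (simp add: c_def)
  qed (simp add: gap_def)
  \<comment> \<open>For $d = 0$ the truncated predecessor is harmless, as both sides are then $0$.\<close>
  have d_pred: "real d * ln (clique_root (d - 1)) = ln (real d + 1)"
    by (cases d) (simp_all add: ln_clique_root add.commute)
  have d_root: "(real d + 1) * ln (clique_root d) = ln (real d + 2)"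
    by (simp add: ln_clique_root)
  have "(\<Sum>u\<in>N. gap u) = c * (ln P - real d * ln (clique_root (d - 1))) - (ln Q - real d * ln (clique_root d))"
    unfolding gap_def
    by (simp add: sum_subtractf sum_distrib_left [symmetric] lnP lnQ d_def)
  also have "\<dots> = ln (real d + 2) + c * (ln P - ln (real d + 1)) - ln (clique_root d * Q)"
    using pos by (simp add: d_pred [symmetric] d_root [symmetric] ln_mult) (simp add: algebra_simps)
  also have "\<dots> \<le> ln (P + 1) - ln (clique_root d * Q)"
    using ln_Suc_tangent [of P "real d + 1"] pos by (simp add: c_def add.assoc)
  finally have gap_le: "(\<Sum>u\<in>N. gap u) \<le> ln (P + 1) - ln (clique_root d * Q)" .
  moreover have "0 \<le> (\<Sum>u\<in>N. gap u)" using gap by (simp add: sum_nonneg)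
  ultimately have "ln (clique_root d * Q) \<le> ln (P + 1)" by linarith
  moreover have cq: "0 < clique_root d * Q" using pos by simp
  ultimately show "clique_root (card N) * (\<Prod>u\<in>N. clique_root (k u)) \<le> (\<Prod>u\<in>N. clique_root (k u - 1)) + 1"
    using pos by (simp add: P_def Q_def d_def)
  have "clique_root d * Q = P + 1 \<longleftrightarrow> (\<forall>u\<in>N. k u = d)"
  proof
    assume "clique_root d * Q = P + 1"
    then have "(\<Sum>u\<in>N. gap u) = 0" using gap_le \<open>0 \<le> (\<Sum>u\<in>N. gap u)\<close> by simp
    then show "\<forall>u\<in>N. k u = d"
      using gap assms(1) by (simp add: sum_nonneg_eq_0_iff)
  next
    assume all: "\<forall>u\<in>N. k u = d"
    have "ln P = ln (real d + 1)" using all d_pred by (simp add: lnP d_def)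
    moreover have "ln (clique_root d * Q) = ln (real d + 2)"
      using all d_root pos by (simp add: ln_mult lnQ d_def [symmetric] algebra_simps)
    ultimately have "P = real d + 1" "clique_root d * Q = real d + 2"
      using pos cq by (simp_all add: add_pos_nonneg)
    then show "clique_root d * Q = P + 1" by simp
  qed
  then show "clique_root (card N) * (\<Prod>u\<in>N. clique_root (k u)) = (\<Prod>u\<in>N. clique_root (k u - 1)) + 1
          \<longleftrightarrow> (\<forall>u\<in>N. k u = card N)"
    by (simp add: P_def Q_def d_def)
qed

section \<open>Independent sets and cluster graphs\<close>

text \<open>
  The induction runs over vertex sets, with a fixed edge relation \<open>E\<close> on the whole type; the pair
  \<open>E\<close>, \<open>V\<close> stands for the subgraph induced on \<open>V\<close>.
\<close>
definition indep_sets :: "'a rel \<Rightarrow> 'a set \<Rightarrow> 'a set set" where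
  "indep_sets E V = {S. S \<subseteq> V \<and> (\<forall>u\<in>S. \<forall>v\<in>S. (u, v) \<notin> E)}"

definition neighbours :: "'a rel \<Rightarrow> 'a set \<Rightarrow> 'a \<Rightarrow> 'a set" where
  "neighbours E V v = {u \<in> V. (v, u) \<in> E}"

definition clique_root_prod :: "'a rel \<Rightarrow> 'a set \<Rightarrow> real" where
  "clique_root_prod E V = (\<Prod>v\<in>V. clique_root (card (neighbours E V v)))"

text \<open>
  For a symmetric relation this says that every connected component is a clique; equivalently,
  there is no induced path on three vertices.
\<close>
definition cluster :: "'a rel \<Rightarrow> 'a set \<Rightarrow> bool" where
  "cluster E V \<longleftrightarrow>
     (\<forall>u\<in>V. \<forall>v\<in>V. \<forall>w\<in>V. (u, v) \<in> E \<longrightarrow> (v, w) \<in> E \<longrightarrow> u \<noteq> w \<longrightarrow> (u, w) \<in> E)"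

lemma clusterD:
  "\<lbrakk>cluster E V; u \<in> V; v \<in> V; w \<in> V; (u, v) \<in> E; (v, w) \<in> E; u \<noteq> w\<rbrakk> \<Longrightarrow> (u, w) \<in> E"
  unfolding cluster_def by blast

text \<open>
  Split by whether \<open>v\<close> belongs to the set: one containing \<open>v\<close> is \<open>v\<close> together with an independent set
  that avoids \<open>v\<close> and all its neighbours.
\<close>
lemma card_indep_sets_rec:
  assumes "finite V" "sym E" "irrefl E" "v \<in> V"
  shows "card (indep_sets E V)
       = card (indep_sets E (V - {v})) + card (indep_sets E (V - {v} - neighbours E V v))"
proof -
  let ?A = "indep_sets E (V - {v})" and ?B = "indep_sets E (V - {v} - neighbours E V v)"
  have fin: "finite (indep_sets E W)" if "W \<subseteq> V" for W
    using finite_subset [OF that assms(1)]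
    by (intro finite_subset [of "indep_sets E W" "Pow W"]) (auto simp: indep_sets_def)
  have "indep_sets E V = ?A \<union> insert v ` ?B"
  proof (intro equalityI subsetI)
    fix S assume S: "S \<in> indep_sets E V"
    show "S \<in> ?A \<union> insert v ` ?B"
    proof (cases "v \<in> S")
      case True
      then have "S - {v} \<in> ?B" using S by (auto simp: indep_sets_def neighbours_def)
      moreover have "S = insert v (S - {v})" using True by auto
      ultimately show ?thesis by blast
    qed (use S in \<open>auto simp: indep_sets_def\<close>)
  next
    fix S assume "S \<in> ?A \<union> insert v ` ?B"
    then show "S \<in> indep_sets E V"
      using assms(2-4) by (auto simp: indep_sets_def neighbours_def irrefl_def dest: symD)
  qed
  moreover have "?A \<inter> insert v ` ?B = {}" by (auto simp: indep_sets_def)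
  moreover have "inj_on (insert v) ?B"
    by (rule inj_onI, subst (asm) insert_ident) (auto simp: indep_sets_def)
  ultimately show ?thesis
    by (simp add: card_Un_disjoint fin card_image Diff_subset subset_iff)
qed

text \<open>
  Passing to an induced subgraph can only lower degrees, hence only raise the factors; the product
  is unchanged precisely when no degree drops.
\<close>
lemma clique_root_prod_induced:
  assumes "finite V" "R \<subseteq> V"
  shows "(\<Prod>v\<in>R. clique_root (card (neighbours E V v))) \<le> clique_root_prod E R"
    and "(\<Prod>v\<in>R. clique_root (card (neighbours E V v))) = clique_root_prod E R
          \<longleftrightarrow> (\<forall>v\<in>R. neighbours E V v \<subseteq> R)"
proof -
  have sub: "neighbours E R v \<subseteq> neighbours E V v" "finite (neighbours E V v)" for v
    using assms by (auto simp: neighbours_def)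
  have le: "clique_root (card (neighbours E V v)) \<le> clique_root (card (neighbours E R v))" for v
    by (intro clique_root_antimono card_mono sub)
  show "(\<Prod>v\<in>R. clique_root (card (neighbours E V v))) \<le> clique_root_prod E R"
    unfolding clique_root_prod_def by (intro prod_mono) (simp add: le less_imp_le)
  show "(\<Prod>v\<in>R. clique_root (card (neighbours E V v))) = clique_root_prod E R
          \<longleftrightarrow> (\<forall>v\<in>R. neighbours E V v \<subseteq> R)"
  proof
    assume eq: "(\<Prod>v\<in>R. clique_root (card (neighbours E V v))) = clique_root_prod E R"
    show "\<forall>v\<in>R. neighbours E V v \<subseteq> R"
    proof (rule ccontr)
      assume "\<not> (\<forall>v\<in>R. neighbours E V v \<subseteq> R)"
      then obtain v where v: "v \<in> R" "neighbours E R v \<subset> neighbours E V v"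
        using sub by (auto simp: neighbours_def)
      have "(\<Prod>v\<in>R. clique_root (card (neighbours E V v))) < clique_root_prod E R"
        unfolding clique_root_prod_def
      proof (rule prod_mono_strict [where i = v])
        show "clique_root (card (neighbours E V v)) < clique_root (card (neighbours E R v))"
          using v sub by (intro clique_root_strict_antimono psubset_card_mono) auto
      qed (use assms v le in \<open>auto intro: finite_subset less_imp_le\<close>)
      then show False using eq by simp
    qed
  next
    assume "\<forall>v\<in>R. neighbours E V v \<subseteq> R"
    then have "neighbours E R v = neighbours E V v" if "v \<in> R" for v
      using that assms by (auto simp: neighbours_def)
    then show "(\<Prod>v\<in>R. clique_root (card (neighbours E V v))) = clique_root_prod E R"
      by (simp add: clique_root_prod_def)
  qed
qed

text \<open>
  The three conditions on the right are exactly the conditions for equality in one step of the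
  induction. They imply that \<open>v\<close> and its neighbours form a clique: a neighbour \<open>u\<close> has no neighbour in
  \<open>R\<close>, so its \<open>card N\<close> neighbours lie among the \<open>card N\<close> other elements of \<open>insert v N\<close> and exhaust them.
\<close>
lemma cluster_iff_split:
  assumes "finite V" "sym E" "irrefl E" "v \<in> V"
  defines "N \<equiv> neighbours E V v"
  defines "R \<equiv> V - {v} - N"
  shows "cluster E V \<longleftrightarrow> cluster E R \<and> (\<forall>u\<in>R. neighbours E V u \<subseteq> R)
           \<and> (\<forall>u\<in>N. card (neighbours E V u) = card N)"
proof
  assume cl: "cluster E V"
  have nbr: "neighbours E V u = insert v N - {u}" if "u \<in> N" for u
  proof (intro equalityI subsetI)
    fix w assume "w \<in> neighbours E V u"
    then show "w \<in> insert v N - {u}"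
      using cl that assms(2-4) unfolding cluster_def N_def neighbours_def irrefl_def by blast
  next
    fix w assume w: "w \<in> insert v N - {u}"
    have uv: "u \<in> V" "(u, v) \<in> E"
      using that assms(2) by (auto simp: N_def neighbours_def dest: symD)
    show "w \<in> neighbours E V u"
    proof (cases "w = v")
      case False
      then have "w \<in> V" "(v, w) \<in> E" "u \<noteq> w" using w by (auto simp: N_def neighbours_def)
      then show ?thesis
        using clusterD [OF cl uv(1) assms(4) _ uv(2), of w] by (simp add: neighbours_def)
    qed (use uv assms(4) in \<open>simp add: neighbours_def\<close>)
  qed
  have "finite N" "v \<notin> N" using assms(1,3) by (auto simp: N_def neighbours_def irrefl_def)
  then have "card (neighbours E V u) = card N" if "u \<in> N" for u
    using that by (simp add: nbr)
  moreover have "neighbours E V u \<subseteq> R" if "u \<in> R" for u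
  proof
    fix w assume w: "w \<in> neighbours E V u"
    then have "(w, u) \<in> E" "w \<in> V" using assms(2) by (auto simp: neighbours_def dest: symD)
    moreover have "w \<notin> N" using nbr [of w] \<open>(w, u) \<in> E\<close> that by (auto simp: R_def neighbours_def)
    moreover have "w \<noteq> v" using \<open>(w, u) \<in> E\<close> that by (auto simp: R_def N_def neighbours_def)
    ultimately show "w \<in> R" by (simp add: R_def)
  qed
  moreover have "cluster E R" using cl by (auto simp: cluster_def R_def)
  ultimately show "cluster E R \<and> (\<forall>u\<in>R. neighbours E V u \<subseteq> R)
      \<and> (\<forall>u\<in>N. card (neighbours E V u) = card N)" by blast
next
  assume asm: "cluster E R \<and> (\<forall>u\<in>R. neighbours E V u \<subseteq> R)
      \<and> (\<forall>u\<in>N. card (neighbours E V u) = card N)"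
  have fin: "finite N" and vN: "v \<notin> N" "N \<subseteq> V"
    using assms(1,3) by (auto simp: N_def neighbours_def irrefl_def)
  have nbr: "neighbours E V u = insert v N - {u}" if "u \<in> insert v N" for u
  proof (rule card_subset_eq)
    show "finite (insert v N - {u})" using fin by simp
    show "neighbours E V u \<subseteq> insert v N - {u}"
    proof
      fix w assume w: "w \<in> neighbours E V u"
      then have wu: "(w, u) \<in> E" "w \<in> V" "w \<noteq> u"
        using assms(2,3) by (auto simp: neighbours_def irrefl_def dest: symD)
      have "u \<in> V" "u \<notin> R" using that vN assms(4) by (auto simp: R_def)
      then have "w \<notin> R" using asm wu by (auto simp: neighbours_def)
      then show "w \<in> insert v N - {u}" using wu by (auto simp: R_def)
    qed
    show "card (neighbours E V u) = card (insert v N - {u})"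
      using asm that fin vN by (auto simp: N_def [symmetric])
  qed
  show "cluster E V"
    unfolding cluster_def
  proof (intro ballI impI)
    fix x y z assume V: "x \<in> V" "y \<in> V" "z \<in> V" and E: "(x, y) \<in> E" "(y, z) \<in> E" "x \<noteq> z"
    show "(x, z) \<in> E"
    proof (cases "x \<in> insert v N")
      case True
      then have "y \<in> insert v N" using nbr [of x] E V by (auto simp: neighbours_def)
      then have "z \<in> insert v N - {x}" using nbr [of y] E V by (auto simp: neighbours_def)
      then show ?thesis using nbr [OF True] by (auto simp: neighbours_def)
    next
      case False
      then have "x \<in> R" using V by (auto simp: R_def)
      then have "y \<in> R" using asm E V by (auto simp: neighbours_def)
      then have "z \<in> R" using asm E V by (auto simp: neighbours_def)
      with asm \<open>x \<in> R\<close> \<open>y \<in> R\<close> E show ?thesis by (blast intro: clusterD)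
    qed
  qed
qed

section \<open>The bound for a symmetric relation\<close>

text \<open>
  The count splits into two terms and each is bounded from below, so equality holds for
  \<open>V\<close> iff it holds in every estimate of the chain
  $i(V) = i(V - v) + i(R) \ge PB + F(R) \ge PB + B \ge f(d) Q B = F(V)$, where $F$ is the product
  of the roots and $B$, $P$, $Q$ are as in the proof.
\<close>
lemma clique_root_prod_le_card_indep_sets:
  assumes "finite V" "sym E" "irrefl E"
  shows "clique_root_prod E V \<le> card (indep_sets E V)
       \<and> (card (indep_sets E V) = clique_root_prod E V \<longleftrightarrow> cluster E V)"
  using assms(1)
proof (induction V rule: finite_psubset_induct)
  case (psubset V)
  show ?case
  proof (cases "V = {}")
    case True
    moreover have "indep_sets E {} = {{}}" by (auto simp: indep_sets_def)
    ultimately show ?thesis by (simp add: clique_root_prod_def cluster_def)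
  next
    case False
    define k where "k u = card (neighbours E V u)" for u
    obtain v where v: "v \<in> V" and max: "\<And>u. u \<in> V \<Longrightarrow> k u \<le> k v"
      using Max_in [of "k ` V"] Max_ge [of "k ` V"] psubset(1) False
      by (metis (no_types, lifting) finite_imageI imageE imageI image_is_empty)
    define N where "N = neighbours E V v"
    define R where "R = V - {v} - N"
    have fin: "finite N" "finite R" and sub: "N \<subseteq> V" "R \<subseteq> V" and vN: "v \<notin> N"
      and kv: "k v = card N"
      using psubset(1) assms(3) by (auto simp: N_def R_def k_def neighbours_def irrefl_def)
    define B where "B = (\<Prod>u\<in>R. clique_root (k u))"
    define P where "P = (\<Prod>u\<in>N. clique_root (k u - 1))"
    define Q where "Q = (\<Prod>u\<in>N. clique_root (k u))"
    have B: "0 < B" by (simp add: B_def prod_pos)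
    have V: "V = insert v (N \<union> R)" "N \<inter> R = {}" "v \<notin> N \<union> R"
      using v sub vN by (auto simp: R_def)
    have kN: "0 < k u \<and> k u \<le> card N" if "u \<in> N" for u
    proof
      have "v \<in> neighbours E V u"
        using that v assms(2) by (auto simp: N_def neighbours_def dest: symD)
      then show "0 < k u" using psubset(1) by (auto simp: k_def neighbours_def card_gt_0_iff)
      show "k u \<le> card N" using max [of u] that sub by (auto simp: kv)
    qed
    have star: "clique_root (k v) * Q \<le> P + 1"
        "clique_root (k v) * Q = P + 1 \<longleftrightarrow> (\<forall>u\<in>N. k u = k v)"
      using clique_root_neighbourhood [OF fin(1), of k] kN by (simp_all add: P_def Q_def kv)
    have F_V: "clique_root_prod E V = clique_root (k v) * Q * B"
    proof -
      have "(\<Prod>u\<in>insert v (N \<union> R). clique_root (k u)) = clique_root (k v) * Q * B"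
        using V(2,3) fin by (simp add: prod.union_disjoint Q_def B_def)
      then show ?thesis by (simp add: clique_root_prod_def k_def [symmetric] flip: V(1))
    qed
    have "neighbours E (V - {v}) u = neighbours E V u - {v}" for u
      by (auto simp: neighbours_def)
    moreover have "v \<in> neighbours E V u \<longleftrightarrow> u \<in> N" if "u \<in> V" for u
      using that v assms(2) by (auto simp: N_def neighbours_def dest: symD)
    ultimately have k_del: "card (neighbours E (V - {v}) u) = (if u \<in> N then k u - 1 else k u)"
      if "u \<in> V" for u
      using that psubset(1) by (auto simp: k_def neighbours_def)
    have "V - {v} = N \<union> R" using V by auto
    then have F_del: "clique_root_prod E (V - {v}) = P * B"
      using V fin sub k_del
      by (auto simp: clique_root_prod_def prod.union_disjoint P_def B_def subset_iff
          intro!: arg_cong2 [where f = "(*)"] prod.cong)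
    note F_R = clique_root_prod_induced [OF psubset(1) sub(2), of E, folded k_def, folded B_def]
    have IH_del: "P * B \<le> card (indep_sets E (V - {v}))"
        "card (indep_sets E (V - {v})) = P * B \<longleftrightarrow> cluster E (V - {v})"
      using psubset(2) [of "V - {v}"] v by (auto simp: F_del)
    have IH_R: "clique_root_prod E R \<le> card (indep_sets E R)"
        "card (indep_sets E R) = clique_root_prod E R \<longleftrightarrow> cluster E R"
      using psubset(2) [of R] v by (auto simp: R_def)
    have split: "real (card (indep_sets E V)) = real (card (indep_sets E (V - {v}))) + real (card (indep_sets E R))"
      using card_indep_sets_rec [OF psubset(1) assms(2,3) v] by (simp add: R_def N_def)
    have PB: "P * B + B = (P + 1) * B" by (simp add: algebra_simps)
    have star_B: "clique_root (k v) * Q * B \<le> P * B + B"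
        "clique_root (k v) * Q * B = P * B + B \<longleftrightarrow> (\<forall>u\<in>N. k u = k v)"
      unfolding PB star(2) [symmetric] using star(1) B by simp_all
    \<comment> \<open>The chain of estimates collapses iff each link is an equality.\<close>
    have "card (indep_sets E V) = clique_root_prod E V \<longleftrightarrow> cluster E (V - {v}) \<and> cluster E R
        \<and> (\<forall>u\<in>R. neighbours E V u \<subseteq> R) \<and> (\<forall>u\<in>N. k u = k v)"
      unfolding IH_del(2) [symmetric] IH_R(2) [symmetric] F_R(2) [symmetric] star_B(2) [symmetric]
      using split IH_del(1) IH_R(1) F_R(1) star_B(1) F_V
      by (intro iffI conjI; (elim conjE)?; linarith)
    moreover have "cluster E V \<longleftrightarrow> cluster E R
        \<and> (\<forall>u\<in>R. neighbours E V u \<subseteq> R) \<and> (\<forall>u\<in>N. k u = k v)"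
      using cluster_iff_split [OF psubset(1) assms(2,3) v]
      by (simp add: k_def N_def [symmetric] R_def [symmetric])
    moreover have "cluster E V \<Longrightarrow> cluster E (V - {v})" by (auto simp: cluster_def)
    moreover have "clique_root_prod E V \<le> card (indep_sets E V)"
      using split IH_del(1) IH_R(1) F_R(1) star_B(1) F_V by linarith
    ultimately show ?thesis by blast
  qed
qed

section \<open>Disjoint unions of cliques as cluster graphs\<close>

text \<open>
  In a cluster graph the closed neighbourhoods $N[v]$ are cliques, and two of them that meet
  coincide, so the subgraphs they induce form the required family. Conversely, every arc lies in
  some member of the family, and two arcs sharing a vertex lie in the same member by disjointness.
\<close>
lemma cluster_iff_disjoint_union_of_cliques:
  assumes "graph G"
  shows "cluster (arcs_ends G) (verts G) \<longleftrightarrow> disjoint_union_of_cliques G"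
proof -
  interpret graph G by fact
  show ?thesis
  proof
    assume cl: "cluster (arcs_ends G) (verts G)"
    define K where "K v = insert v (neighbours (arcs_ends G) (verts G) v)" for v
    have K_sub: "K v \<subseteq> verts G" if "v \<in> verts G" for v
      using that by (auto simp: K_def neighbours_def)
    have K_adj: "x \<rightarrow>\<^bsub>G\<^esub> y" if "x \<in> K v" "y \<in> K v" "x \<noteq> y" "v \<in> verts G" for v x y
      using that cl graph_symmetric unfolding K_def neighbours_def cluster_def by blast
    have K_eq: "K v = K w" if "x \<in> K v" "x \<in> K w" "v \<in> verts G" "w \<in> verts G" for v w x
    proof -
      have "v = w \<or> v \<rightarrow>\<^bsub>G\<^esub> w"
        using that cl graph_symmetric unfolding K_def neighbours_def cluster_def by blast
      then have "v \<in> K w" "w \<in> K v"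
        using that graph_symmetric by (auto simp: K_def neighbours_def)
      moreover have "y \<in> K w" if "y \<in> K v" "v \<in> K w" "v \<in> verts G" "w \<in> verts G" for v w y
        using that cl unfolding K_def neighbours_def cluster_def by blast
      ultimately show ?thesis using that by blast
    qed
    have clique: "clique_graph (G \<restriction> K v)" if v: "v \<in> verts G" for v
    proof -
      interpret H: wf_digraph "G \<restriction> K v" by (rule wellformed_induce_subgraph)
      have fin: "finite (K v)" using K_sub [OF v] by (rule finite_subset) simp
      have ends: "arcs_ends (G \<restriction> K v) = {(x, y). (x, y) \<in> K v \<times> K v \<and> x \<noteq> y}"
        using K_adj v by (fastforce simp: arcs_ends_conv dest: no_loops)
      have "graph (G \<restriction> K v)"
      proof
        show "symmetric (G \<restriction> K v)" by (auto simp: symmetric_def ends sym_def)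
      qed (auto simp: fin no_loops arc_to_ends_def no_multi_arcs)
      moreover have "1 \<le> card (K v)" using fin by (simp add: K_def card_gt_0_iff Suc_le_eq)
      ultimately show ?thesis by (auto simp: clique_graph_def complete_digraph_def ends)
    qed
    let ?C = "(\<lambda>v. G \<restriction> K v) ` verts G"
    have cliques: "\<forall>H\<in>?C. subgraph H G \<and> clique_graph H"
      using clique K_sub
      by (auto simp: subgraph_def compatible_def wellformed_induce_subgraph wf_digraph)
    have disjoint: "\<forall>H\<in>?C. \<forall>H'\<in>?C. H \<noteq> H' \<longrightarrow> verts H \<inter> verts H' = {}"
    proof (intro ballI impI equals0I)
      fix H H' x assume "H \<in> ?C" "H' \<in> ?C" "H \<noteq> H'" and x: "x \<in> verts H \<inter> verts H'"
      then obtain v w where vw: "v \<in> verts G" "w \<in> verts G"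
        and H: "H = G \<restriction> K v" "H' = G \<restriction> K w" by blast
      have "K v = K w" by (rule K_eq [of x]) (use x vw H in auto)
      then show False using \<open>H \<noteq> H'\<close> H by simp
    qed
    have union: "G = Union ?C"
    proof (rule pre_digraph.equality)
      show "verts G = verts (Union ?C)" using K_sub by (auto simp: Union_def K_def)
      have "arcs G \<subseteq> arcs (Union ?C)"
      proof
        fix e assume "e \<in> arcs G"
        then have "tail G e \<in> verts G" "e \<in> arcs (G \<restriction> K (tail G e))"
          by (auto simp: K_def neighbours_def arcs_ends_conv)
        then show "e \<in> arcs (Union ?C)"
          by (auto simp: Union_def simp del: induce_subgraph_arcs)
      qed
      then show "arcs G = arcs (Union ?C)" by (auto simp: Union_def)
    qed (auto simp: Union_def)
    show "disjoint_union_of_cliques G"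
      unfolding disjoint_union_of_cliques_def
      using cliques disjoint union by (intro exI [of _ ?C] conjI)
  next
    assume "disjoint_union_of_cliques G"
    then obtain C where C: "\<forall>H\<in>C. subgraph H G \<and> clique_graph H"
      and disj: "\<forall>H\<in>C. \<forall>H'\<in>C. H \<noteq> H' \<longrightarrow> verts H \<inter> verts H' = {}"
      and G: "G = Union C"
      unfolding disjoint_union_of_cliques_def by (elim exE conjE)
    have in_C: "\<exists>H\<in>C. u \<in> verts H \<and> v \<in> verts H" if uv: "u \<rightarrow>\<^bsub>G\<^esub> v" for u v
    proof -
      obtain e where e: "e \<in> arcs G" "tail G e = u" "head G e = v" using uv by blast
      moreover have "arcs G = (\<Union>H\<in>C. arcs H)" by (subst G) (simp add: Union_def)
      ultimately obtain H where H: "H \<in> C" "e \<in> arcs H" by auto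
      then have "wf_digraph H" "tail H = tail G" "head H = head G"
        using C by (auto simp: subgraph_def compatible_def)
      then show ?thesis using H e by (auto simp: wf_digraph_def)
    qed
    show "cluster (arcs_ends G) (verts G)"
      unfolding cluster_def
    proof (intro ballI impI)
      fix u v w assume "u \<rightarrow>\<^bsub>G\<^esub> v" "v \<rightarrow>\<^bsub>G\<^esub> w" "u \<noteq> w"
      then obtain H where H: "H \<in> C" "u \<in> verts H" "w \<in> verts H"
        using in_C disj by (metis IntI empty_iff)
      then have "(u, w) \<in> arcs_ends H"
        using C \<open>u \<noteq> w\<close> by (auto simp: clique_graph_def complete_digraph_def)
      then show "u \<rightarrow>\<^bsub>G\<^esub> w" using C H by (auto simp: subgraph_def compatible_def arcs_ends_conv)
    qed
  qed
qed

text \<open>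
  The out-degree counts arcs; without parallel arcs the arcs leaving \<open>v\<close> are determined by their
  heads.
\<close>
lemma out_degree_eq_card_neighbours:
  assumes "graph G"
  shows "out_degree G v = card (neighbours (arcs_ends G) (verts G) v)"
proof -
  interpret graph G by fact
  have "neighbours (arcs_ends G) (verts G) v = head G ` out_arcs G v"
    by (auto simp: neighbours_def arcs_ends_conv out_arcs_def)
  moreover have "inj_on (head G) (out_arcs G v)"
    by (auto simp: inj_on_def arc_to_ends_def intro: no_multi_arcs)
  ultimately show ?thesis by (simp add: out_degree_def card_image)
qed

theorem theorem1p4:
  fixes G :: "('a, 'b) pre_digraph"
  assumes "graph G"
  shows "real (num_independent_sets G) \<ge>
           (\<Prod>v\<in>verts G. (real (out_degree G v) + 2) powr (1 / (real (out_degree G v) + 1)))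
       \<and> (real (num_independent_sets G) =
           (\<Prod>v\<in>verts G. (real (out_degree G v) + 2) powr (1 / (real (out_degree G v) + 1)))
         \<longleftrightarrow> disjoint_union_of_cliques G)"
proof -
  interpret graph G by fact
  let ?E = "arcs_ends G"
  have "sym ?E" "irrefl ?E"
    using graph_symmetric adj_not_same by (auto simp: sym_def irrefl_def)
  then have "clique_root_prod ?E (verts G) \<le> card (indep_sets ?E (verts G))
      \<and> (card (indep_sets ?E (verts G)) = clique_root_prod ?E (verts G) \<longleftrightarrow> disjoint_union_of_cliques G)"
    unfolding cluster_iff_disjoint_union_of_cliques [OF assms, symmetric]
    by (rule clique_root_prod_le_card_indep_sets [OF finite_verts])
  moreover have "card (indep_sets ?E (verts G)) = num_independent_sets G"
    by (simp add: num_independent_sets_def indep_sets_def independent_set_def)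
  ultimately show ?thesis
    by (simp add: clique_root_prod_def clique_root_def out_degree_eq_card_neighbours [OF assms])
qed

end
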